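(* Let $X$ be a metric space equipped with a closed partial order $\le$, and let $\mu,\nu\in\mathcal{P}(X)$. Then the following are equivalent: (1) $\mu\le\nu$ in the stochastic order; (2) for every monotone Borel function $f:X\to[0,\infty)$, $\int_X f\,d\mu\le\int_X f\,d\nu$; (2$'$) for every monotone bounded Borel function $f:X\to[0,\infty)$, $\int_X f\,d\mu\le\int_X f\,d\nu$; (3) for every monotone lower semicontinuous function $f:X\to[0,\infty)$, $\int_X f\,d\mu\le\int_X f\,d\nu$; (3$'$) for every monotone bounded lower semicontinuous function $f:X\to[0,\infty)$, $\int_X f\,d\mu\le\int_X f\,d\nu$. (Integrals are allowed to be $+\infty$.)
   Context: A partial order $\le$ on a metric space $X$ is closed if $\{(x,y):x\le y\}$ is closed in $X\times X$. A subset $A\subseteq X$ is an upper set if $x\in A$ and $x\le y$ imply $y\in A$. A function $f:X\to[0,\infty)$ is monotone if $x\le y$ implies $f(x)\le f(y)$. $\mathcal{P}(X)$ denotes the set of Borel probability measures $\mu$ on $X$ satisfying all four of the following conditions: the support of $\mu$ has measure $1$; $\mu$ is $\tau$-additive, i.e. $\mu(U)=\sup_\alpha\mu(U_\alpha)$ for every directed union $U=\bigcup_\alpha U_\alpha$ of open sets; $\mu$ is the weak limit of a sequence of finitely supported measures; $\mu$ is inner regular, i.e. for every Borel set $A$ and $\varepsilon>0$ there is a compact $K\subseteq A$ with $\mu(A)-\varepsilon<\mu(K)$. (The first three are always equivalent, and all four are equivalent when $X$ is complete.) The stochastic order on $\mathcal{P}(X)$ is defined by: $\mu\le\nu$ if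 $\mu(U)\le\nu(U)$ for each open upper set $U\subseteq X$. *)

theory Defs
  imports "HOL-Probability.Probability"
begin

definition measure_support :: "'a::topological_space measure \<Rightarrow> 'a set" where
  "measure_support M = {x. \<forall>U. open U \<and> x \<in> U \<longrightarrow> emeasure M U > 0}"

text \<open>The directed family of open sets is given as a set of sets.\<close>

definition tau_additive :: "'a::topological_space measure \<Rightarrow> bool" where
  "tau_additive M \<longleftrightarrow>
     (\<forall>\<U>. \<U> \<noteq> {} \<and> (\<forall>U\<in>\<U>. open U) \<and> (\<forall>U\<in>\<U>. \<forall>V\<in>\<U>. \<exists>W\<in>\<U>. U \<union> V \<subseteq> W) \<longrightarrow>
        emeasure M (\<Union>\<U>) = (SUP U\<in>\<U>. emeasure M U))"

definition finitely_supported :: "'a::topological_space measure \<Rightarrow> bool" where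
  "finitely_supported M \<longleftrightarrow> (\<exists>F. finite F \<and> emeasure M (UNIV - F) = 0)"

text \<open>Weak convergence is tested against bounded continuous real functions. It is meant for
  finite Borel measures only: there such functions are integrable, so the Bochner integral
  does not take its default value.\<close>

definition weak_limit :: "(nat \<Rightarrow> 'a::topological_space measure) \<Rightarrow> 'a measure \<Rightarrow> bool" where
  "weak_limit N M \<longleftrightarrow>
     (\<forall>f::'a \<Rightarrow> real. continuous_on UNIV f \<and> bounded (range f) \<longrightarrow>
        (\<lambda>n. \<integral>x. f x \<partial>N n) \<longlonglongrightarrow> (\<integral>x. f x \<partial>M))"

text \<open>The approximating measures are not required to be normalised; testing against the constant
  function 1 shows that their total masses tend to that of the limit.\<close>

definition weak_limit_of_finitely_supported :: "'a::topological_space measure \<Rightarrow> bool" where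
  "weak_limit_of_finitely_supported M \<longleftrightarrow>
     (\<exists>N. (\<forall>n. sets (N n) = sets borel \<and> finite_measure (N n) \<and> finitely_supported (N n)) \<and>
          weak_limit N M)"

definition inner_regular :: "'a::topological_space measure \<Rightarrow> bool" where
  "inner_regular M \<longleftrightarrow>
     (\<forall>A\<in>sets borel. \<forall>\<epsilon>>0. \<exists>K. compact K \<and> K \<subseteq> A \<and> measure M A - \<epsilon> < measure M K)"

definition prob_measures :: "'a::metric_space measure set" where
  "prob_measures =
     {M. prob_space M \<and> sets M = sets borel \<and>
         emeasure M (measure_support M) = 1 \<and>
         tau_additive M \<and>
         weak_limit_of_finitely_supported M \<and>
         inner_regular M}"

definition upper_set :: "'a::order set \<Rightarrow> bool" where
  "upper_set A \<longleftrightarrow> (\<forall>x y. x \<in> A \<and> x \<le> y \<longrightarrow> y \<in> A)"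

definition stochastic_le :: "'a::{metric_space,order} measure \<Rightarrow> 'a measure \<Rightarrow> bool" where
  "stochastic_le \<mu> \<nu> \<longleftrightarrow> (\<forall>U. open U \<and> upper_set U \<longrightarrow> emeasure \<mu> U \<le> emeasure \<nu> U)"

definition lower_semicontinuous :: "('a::topological_space \<Rightarrow> real) \<Rightarrow> bool" where
  "lower_semicontinuous f \<longleftrightarrow> (\<forall>x. \<forall>c<f x. \<forall>\<^sub>F y in nhds x. c < f y)"

end

theory Submission
  imports Defs
begin

text \<open>If \<open>B\<close> is a Borel upper set and \<open>K\<close> a compact subset of its complement, then the down-closure
  of \<open>K\<close> is closed because the order is, it still misses \<open>B\<close>, and its complement is an open upper set.
  Inner regularity of \<open>\<nu>\<close> on the complement of \<open>B\<close> therefore carries the inequality \<open>\<mu> U \<le> \<nu> U\<close> from open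
  upper sets to all Borel upper sets. Superlevel sets of monotone functions are upper sets, so the
  layer cake formula turns this into an inequality of integrals. Conversely, the indicator of an
  open upper set is monotone, bounded and lower semicontinuous.\<close>

text \<open>If points of the down-closure converge to \<open>l\<close>, compactness makes a
  subsequence of their upper bounds in \<open>K\<close> converge to some \<open>m\<close> in
  \<open>K\<close>. The pairs then converge to \<open>(l, m)\<close>, and closedness of the order
  gives l \<le> m.\<close>

lemma closed_down_closure_compact:
  fixes K :: "'a::{metric_space,order} set"
  assumes order: "closed {(x, y). x \<le> (y::'a)}" and K: "compact K"
  shows "closed {x. \<exists>k\<in>K. x \<le> k}"
  unfolding closed_sequential_limits
proof (intro allI impI, elim conjE)
  fix x l
  assume "\<forall>n. x n \<in> {x. \<exists>k\<in>K. x \<le> k}" and lim: "x \<longlonglongrightarrow> l"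
  then obtain k where k: "\<And>n. k n \<in> K" "\<And>n. x n \<le> k n"
    by (simp add: Bex_def) metis
  obtain m r where m: "m \<in> K" and r: "strict_mono (r :: nat \<Rightarrow> nat)" "(k \<circ> r) \<longlonglongrightarrow> m"
    using K k(1) unfolding compact_def by blast
  have "(\<lambda>n. ((x \<circ> r) n, (k \<circ> r) n)) \<longlonglongrightarrow> (l, m)"
    using r(2) LIMSEQ_subseq_LIMSEQ[OF lim r(1)] by (rule tendsto_Pair[rotated])
  then have "(l, m) \<in> {(x, y). x \<le> y}"
    by (rule closed_sequentially[OF order, rotated]) (simp add: k(2))
  with m show "l \<in> {x. \<exists>k\<in>K. x \<le> k}" by auto
qed

lemma stochastic_le_borel_upper_set:
  fixes \<mu> \<nu> :: "'a::{metric_space,order} measure"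
  assumes order: "closed {(x, y). x \<le> (y::'a)}"
    and \<mu>: "prob_space \<mu>" "sets \<mu> = sets borel"
    and \<nu>: "prob_space \<nu>" "sets \<nu> = sets borel" "inner_regular \<nu>"
    and le: "stochastic_le \<mu> \<nu>"
    and B: "B \<in> sets borel" "upper_set B"
  shows "emeasure \<mu> B \<le> emeasure \<nu> B"
proof -
  interpret \<mu>: prob_space \<mu> by fact
  interpret \<nu>: prob_space \<nu> by fact
  have space: "space \<mu> = UNIV" "space \<nu> = UNIV"
    using \<mu>(2) \<nu>(2) by (simp_all add: sets_eq_imp_space_eq)
  have compl: "measure \<mu> (- A) = 1 - measure \<mu> A" "measure \<nu> (- A) = 1 - measure \<nu> A"
    if "A \<in> sets borel" for A
    using that \<mu>.prob_compl[of A] \<nu>.prob_compl[of A] \<mu>(2) \<nu>(2)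
    by (simp_all add: space Compl_eq_Diff_UNIV)
  \<comment> \<open>Inner regularity bounds measures from below by compact sets, so it is applied to
    the complement, where the desired inequality is reversed.\<close>
  have "measure \<nu> (- B) \<le> measure \<mu> (- B) + \<epsilon>" if "\<epsilon> > 0" for \<epsilon>
  proof -
    obtain K where K: "compact K" "K \<subseteq> - B" "measure \<nu> (- B) - \<epsilon> < measure \<nu> K"
      using \<nu>(3) B(1) \<open>\<epsilon> > 0\<close> unfolding inner_regular_def by (metis borel_comp)
    \<comment> \<open>With this \<open>L\<close> the chain is \<nu>(-B) - \<epsilon> < \<nu>(K)
      \<le> \<nu>(L) \<le> \<mu>(L) \<le> \<mu>(-B). The third comparison is the stochastic order on
      the open upper set \<open>- L\<close>, read on complements.\<close>
    define L where "L = {x. \<exists>k\<in>K. x \<le> k}"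
    have L: "closed L"
      unfolding L_def using order K(1) by (rule closed_down_closure_compact)
    have "upper_set (- L)"
      unfolding upper_set_def L_def by (auto intro: order_trans)
    then have "measure \<mu> (- L) \<le> measure \<nu> (- L)"
      using le L unfolding stochastic_le_def
      by (simp add: open_Compl \<mu>.emeasure_eq_measure \<nu>.emeasure_eq_measure)
    then have "measure \<nu> L \<le> measure \<mu> L"
      using L by (simp add: compl)
    moreover have "L \<subseteq> - B"
      using K(2) B(2) unfolding L_def upper_set_def by blast
    then have "measure \<mu> L \<le> measure \<mu> (- B)"
      using B(1) \<mu>(2) by (intro \<mu>.finite_measure_mono) auto
    moreover have "measure \<nu> K \<le> measure \<nu> L"
      using L \<nu>(2) by (intro \<nu>.finite_measure_mono) (auto simp: L_def)
    ultimately show ?thesis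
      using K(3) by linarith
  qed
  then have "measure \<nu> (- B) \<le> measure \<mu> (- B)"
    by (rule field_le_epsilon)
  then show ?thesis
    using B(1) by (simp add: compl \<mu>.emeasure_eq_measure \<nu>.emeasure_eq_measure)
qed

text \<open>The value \<open>f x\<close> is the length of \<open>{0..<f x}\<close>, that is, an
  integral over \<open>t\<close> of an indicator. Exchanging the two integrals leaves the measure of
  a superlevel set.\<close>

lemma nn_integral_layer_cake:
  fixes f :: "'a \<Rightarrow> real"
  assumes "sigma_finite_measure M" and [measurable]: "f \<in> borel_measurable M" and nonneg: "\<And>x. 0 \<le> f x"
  shows "(\<integral>\<^sup>+x. ennreal (f x) \<partial>M) =
    (\<integral>\<^sup>+t. indicator {0..} t * emeasure M {x\<in>space M. t < f x} \<partial>lborel)"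
proof -
  interpret sigma_finite_measure M by fact
  interpret pair_sigma_finite M lborel ..
  let ?h = "\<lambda>x t. indicator {0..} t * indicator {x\<in>space M. t < f x} x :: ennreal"
  have "(\<integral>\<^sup>+x. ennreal (f x) \<partial>M) = (\<integral>\<^sup>+x. \<integral>\<^sup>+t. ?h x t \<partial>lborel \<partial>M)"
  proof (rule nn_integral_cong)
    fix x assume "x \<in> space M"
    then have "(\<integral>\<^sup>+t. ?h x t \<partial>lborel) = (\<integral>\<^sup>+t. indicator {0..<f x} t \<partial>lborel)"
      by (intro nn_integral_cong) (auto simp: indicator_def)
    then show "ennreal (f x) = (\<integral>\<^sup>+t. ?h x t \<partial>lborel)"
      using nonneg by simp
  qed
  \<comment> \<open>Tonelli for sigma-finite measures: the integrand is nonnegative and jointly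
    measurable.\<close>
  also have "\<dots> = (\<integral>\<^sup>+t. \<integral>\<^sup>+x. ?h x t \<partial>M \<partial>lborel)"
    by (rule Fubini'[symmetric]) measurable
  also have "\<dots> = (\<integral>\<^sup>+t. indicator {0..} t * emeasure M {x\<in>space M. t < f x} \<partial>lborel)"
    by (simp add: nn_integral_cmult)
  finally show ?thesis .
qed

text \<open>The layer cake formula turns both sides into integrals over \<open>t\<close>, compared
  pointwise; for negative \<open>t\<close> both integrands vanish.\<close>

lemma nn_integral_mono_on_superlevel_sets:
  fixes f :: "'a \<Rightarrow> real"
  assumes "sigma_finite_measure M" "sigma_finite_measure N" "sets M = sets N"
    and "f \<in> borel_measurable M" "\<And>x. 0 \<le> f x"
    and le: "\<And>t. 0 \<le> t \<Longrightarrow> emeasure M {x\<in>space M. t < f x} \<le> emeasure N {x\<in>space M. t < f x}"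
  shows "(\<integral>\<^sup>+x. ennreal (f x) \<partial>M) \<le> (\<integral>\<^sup>+x. ennreal (f x) \<partial>N)"
proof -
  have "f \<in> borel_measurable N" "space N = space M"
    using assms(4) measurable_cong_sets[OF assms(3) refl] sets_eq_imp_space_eq[OF assms(3)] by auto
  then show ?thesis
    using assms(1,2,4,5)
    by (simp add: nn_integral_layer_cake)
      (intro nn_integral_mono, simp add: indicator_def le)
qed

text \<open>For fixed \<open>c\<close>, the pointwise condition says that each point of the
  superlevel set has a neighbourhood inside it.\<close>

lemma lower_semicontinuous_iff_open:
  "lower_semicontinuous f \<longleftrightarrow> (\<forall>c. open {x. c < f x})"
proof -
  have "open {x. c < f x} \<longleftrightarrow> (\<forall>x. c < f x \<longrightarrow> (\<forall>\<^sub>F y in nhds x. c < f y))" for c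
    by (subst open_subopen) (auto simp: eventually_nhds subset_eq)
  then show ?thesis
    unfolding lower_semicontinuous_def by blast
qed

lemma lower_semicontinuous_borel_measurable:
  "lower_semicontinuous f \<Longrightarrow> f \<in> borel_measurable borel"
  by (rule borel_measurableI_greater) (simp add: lower_semicontinuous_iff_open)

lemma lower_semicontinuous_indicator:
  assumes "open U"
  shows "lower_semicontinuous (indicator U)"
  unfolding lower_semicontinuous_iff_open
proof
  fix c :: real
  have "{x. c < indicator U x} = (if c < 0 then UNIV else if c < 1 then U else {})"
    by (auto simp: indicator_def)
  then show "open {x. c < indicator U x}"
    using assms by simp
qed

lemma mono_indicator_upper_set:
  "upper_set U \<Longrightarrow> mono (indicator U :: 'a::order \<Rightarrow> real)"
  unfolding upper_set_def mono_def by (auto simp: indicator_def)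

theorem proposition3p6:
  fixes \<mu> \<nu> :: "'a::{metric_space,order} measure"
  assumes closed_order: "closed {(x, y). x \<le> (y::'a)}"
    and \<mu>: "\<mu> \<in> prob_measures"
    and \<nu>: "\<nu> \<in> prob_measures"
  shows
    "(stochastic_le \<mu> \<nu> \<longleftrightarrow>
        (\<forall>f::'a \<Rightarrow> real. (\<forall>x. 0 \<le> f x) \<and> mono f \<and> f \<in> borel_measurable borel \<longrightarrow>
           (\<integral>\<^sup>+x. ennreal (f x) \<partial>\<mu>) \<le> (\<integral>\<^sup>+x. ennreal (f x) \<partial>\<nu>))) \<and>
     (stochastic_le \<mu> \<nu> \<longleftrightarrow>
        (\<forall>f::'a \<Rightarrow> real. (\<forall>x. 0 \<le> f x) \<and> mono f \<and> bounded (range f) \<and> f \<in> borel_measurable borel \<longrightarrow>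
           (\<integral>\<^sup>+x. ennreal (f x) \<partial>\<mu>) \<le> (\<integral>\<^sup>+x. ennreal (f x) \<partial>\<nu>))) \<and>
     (stochastic_le \<mu> \<nu> \<longleftrightarrow>
        (\<forall>f::'a \<Rightarrow> real. (\<forall>x. 0 \<le> f x) \<and> mono f \<and> lower_semicontinuous f \<longrightarrow>
           (\<integral>\<^sup>+x. ennreal (f x) \<partial>\<mu>) \<le> (\<integral>\<^sup>+x. ennreal (f x) \<partial>\<nu>))) \<and>
     (stochastic_le \<mu> \<nu> \<longleftrightarrow>
        (\<forall>f::'a \<Rightarrow> real. (\<forall>x. 0 \<le> f x) \<and> mono f \<and> bounded (range f) \<and> lower_semicontinuous f \<longrightarrow>
           (\<integral>\<^sup>+x. ennreal (f x) \<partial>\<mu>) \<le> (\<integral>\<^sup>+x. ennreal (f x) \<partial>\<nu>)))"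
proof -
  have prob: "prob_space \<mu>" "prob_space \<nu>"
    and sets: "sets \<mu> = sets borel" "sets \<nu> = sets borel"
    and reg: "inner_regular \<nu>"
    using \<mu> \<nu> by (auto simp: prob_measures_def)
  let ?le = "\<lambda>f::'a \<Rightarrow> real. (\<integral>\<^sup>+x. ennreal (f x) \<partial>\<mu>) \<le> (\<integral>\<^sup>+x. ennreal (f x) \<partial>\<nu>)"
  \<comment> \<open>The strongest of the four integral conditions; the other three restrict the
    class of \<open>f\<close>, since lower semicontinuous functions are Borel.\<close>
  have borel: "?le f"
    if le: "stochastic_le \<mu> \<nu>" and f: "\<forall>x. 0 \<le> f x" "mono f" "f \<in> borel_measurable borel" for f
  proof (rule nn_integral_mono_on_superlevel_sets)
    fix t :: real
    have space: "space \<mu> = UNIV"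
      using sets(1) by (simp add: sets_eq_imp_space_eq)
    have "{x. t < f x} \<in> sets borel"
      using f(3) by measurable
    moreover have "upper_set {x. t < f x}"
      using f(2) unfolding upper_set_def mono_def by (auto intro: less_le_trans)
    ultimately show "emeasure \<mu> {x\<in>space \<mu>. t < f x} \<le> emeasure \<nu> {x\<in>space \<mu>. t < f x}"
      using stochastic_le_borel_upper_set[OF closed_order prob(1) sets(1) prob(2) sets(2) reg le]
      by (simp add: space)
  qed (use f prob sets in \<open>auto simp: prob_space_imp_sigma_finite cong: measurable_cong_sets\<close>)
  \<comment> \<open>The weakest of the four conditions already implies the stochastic order, so each
    of the others does as well.\<close>
  have bounded_lsc: "stochastic_le \<mu> \<nu>"
    if le: "\<forall>f. (\<forall>x. 0 \<le> f x) \<and> mono f \<and> bounded (range f) \<and> lower_semicontinuous f \<longrightarrow> ?le f"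
    unfolding stochastic_le_def
  proof (intro allI impI, elim conjE)
    fix U :: "'a set" assume U: "open U" "upper_set U"
    have "range (indicator U :: 'a \<Rightarrow> real) \<subseteq> {0, 1}"
      by (auto simp: indicator_def)
    then have "bounded (range (indicator U :: 'a \<Rightarrow> real))"
      by (rule bounded_subset[rotated]) simp
    then have "?le (indicator U)"
      using le U by (simp add: lower_semicontinuous_indicator mono_indicator_upper_set)
    then show "emeasure \<mu> U \<le> emeasure \<nu> U"
      using U(1) by (simp add: ennreal_indicator sets)
  qed
  show ?thesis
    using borel bounded_lsc
    by (intro conjI iffI allI impI) (simp_all add: lower_semicontinuous_borel_measurable)
qed

end
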